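(* Let $n,k$ be integers with $1\le k\le \frac n2-1$, and let $T\in\mathcal T_{n,k}$. Put $\Delta=\left\lfloor \frac{n-2}{k}\right\rfloor+1$, $p=\left\lfloor \frac{n-2-k(\Delta-1)}{\Delta-2}\right\rfloor$ and $\mu=n-1-k(\Delta-1)-p(\Delta-2)$. Then $$\prod\nolimits_1(T)\ \ge\ \Delta^{2k}(\Delta-1)^{2p}\mu^{2},$$ and equality holds if and only if the degree sequence of $T$ is $$(\underbrace{\Delta,\ldots,\Delta}_{k},\underbrace{\Delta-1,\ldots,\Delta-1}_{p},\mu,\underbrace{1,\ldots,1}_{n-k-p-1}).$$
   Context: All graphs are finite, simple, connected and undirected; $d(v)$ denotes the degree of a vertex $v$. $\mathcal T_{n,k}$ is the class of trees with $n$ vertices in which exactly $k$ vertices have degree equal to the maximum vertex degree of the tree. The first multiplicative Zagreb index of a graph $G$ is $\prod_1(G)=\prod_{u\in V(G)}d(u)^2$. The degree sequence of a graph is the list of its vertex degrees in non-increasing order. *)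

theory Defs
  imports Complex_Main "HOL-Library.Multiset" "Graph_Theory.Digraph_Component"
begin

text \<open>
  A finite simple undirected graph is a \<open>pair_graph\<close>: a finite loop-free digraph without parallel
  arcs whose arc relation is symmetric, so that the edge \<open>uv\<close> is the pair of arcs \<open>(u, v)\<close>, \<open>(v, u)\<close>.
  Each edge at \<open>v\<close> contributes exactly one arc leaving \<open>v\<close>, so the out-degree is the
  undirected degree.
\<close>

definition degree :: "'a pair_pre_digraph \<Rightarrow> 'a \<Rightarrow> nat" where
  "degree G v = out_degree (with_proj G) v"

definition max_degree :: "'a pair_pre_digraph \<Rightarrow> nat" where
  "max_degree G = Max (degree G ` pverts G)"

text \<open>
  The library constant \<^const>\<open>tree\<close> is unsuitable for symmetric digraphs: it counts the closed walk
  \<open>u, v, u\<close> along a single edge as a cycle. The cycles of the undirected graph are the library's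
  cycles of length at least 3.
\<close>

definition undirected_tree :: "'a pair_pre_digraph \<Rightarrow> bool" where
  "undirected_tree G \<longleftrightarrow>
     pair_graph G \<and> connected (with_proj G) \<and>
     \<not> (\<exists>c. pre_digraph.cycle (with_proj G) c \<and> 3 \<le> length c)"

definition tree_class :: "nat \<Rightarrow> nat \<Rightarrow> 'a pair_pre_digraph set" where
  "tree_class n k =
     {T. undirected_tree T \<and> card (pverts T) = n \<and>
         card {v \<in> pverts T. degree T v = max_degree T} = k}"

definition first_mult_zagreb :: "'a pair_pre_digraph \<Rightarrow> nat" where
  "first_mult_zagreb G = (\<Prod>u \<in> pverts G. (degree G u)\<^sup>2)"

definition degree_sequence :: "'a pair_pre_digraph \<Rightarrow> nat list" where
  "degree_sequence G =
     rev (sorted_list_of_multiset (image_mset (degree G) (mset_set (pverts G))))"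

end

theory Submission
  imports Defs
begin

text \<open>
  In a tree the excesses \<open>d(v) - 1\<close> sum to \<open>n - 2\<close>. A product of numbers \<open>x + 1\<close> with
  \<open>0 \<le> x \<le> c\<close> and prescribed \<open>\<Sum>x\<close> is smallest when the sum is filled up greedily by copies
  of \<open>c\<close>. If the maximum degree is \<open>\<Delta>\<close>, this applies to the remaining \<open>n - k\<close> vertices with
  \<open>c = \<Delta> - 2\<close>. Otherwise the maximum degree is smaller than \<open>\<Delta>\<close>, all excesses are at most
  \<open>\<Delta> - 2\<close>, and the greedy filling of \<open>n - 2\<close> by copies of \<open>\<Delta> - 2\<close> already has a strictly
  larger product than the claimed bound.
\<close>

section \<open>Degree sum of a tree, by counting arcs\<close>

context pair_graph
begin

lemma sum_degree: "(\<Sum>v\<in>pverts G. degree G v) = card (parcs G)"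
proof -
  have "parcs G = (\<Union>v\<in>pverts G. out_arcs G v)"
    by (auto simp: out_arcs_def dest: in_arcsD1)
  moreover have "card (\<Union>v\<in>pverts G. out_arcs G v) = (\<Sum>v\<in>pverts G. card (out_arcs G v))"
    by (rule card_UN_disjoint) (auto simp: out_arcs_def)
  ultimately show ?thesis
    by (simp add: degree_def out_degree_def)
qed

lemma connected_boundary_arc:
  assumes "connected (with_proj G)" "S \<subseteq> pverts G" "S \<noteq> {}" "S \<noteq> pverts G"
  obtains x v where "(x, v) \<in> parcs G" "x \<in> S" "v \<notin> S"
proof -
  obtain u w where uw: "u \<in> S" "w \<in> pverts G" "w \<notin> S"
    using assms by blast
  \<comment> \<open>\<open>connected\<close> means strong connectivity of the symmetric closure. The
    arcs are symmetric already, so reachability there is reachability in the graph itself.\<close>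
  have "u \<rightarrow>\<^sup>*\<^bsub>with_proj G\<^esub> w"
    using assms(1,2) uw
    by (auto simp: connected_def strongly_connected_def reachable_mk_symmetric_eq[OF sym_arcs])
  then have "w \<in> S \<or> (\<exists>x v. (x, v) \<in> parcs G \<and> x \<in> S \<and> v \<notin> S)"
  proof (induct rule: reachable_induct)
    case base
    then show ?case using uw by simp
  next
    case (step x y)
    then show ?case by auto
  qed
  then show thesis
    using uw that by blast
qed

text \<open>Connectedness of the subgraph induced on \<open>S\<close>, phrased through simple paths
  that stay inside \<open>S\<close>. In this form a path can be closed up to a cycle through a
  vertex outside \<open>S\<close>.\<close>

definition path_connected_in :: "'a set \<Rightarrow> bool" where
  "path_connected_in S \<longleftrightarrow>
     (\<forall>u\<in>S. \<forall>w\<in>S. \<exists>p. apath u p w \<and> set (awalk_verts u p) \<subseteq> S)"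

text \<open>Paths from \<open>v\<close> start with the arc to \<open>x\<close> and stay simple
  because \<open>v\<close> is not in \<open>S\<close>. Paths to \<open>v\<close> are their
  reversals.\<close>

lemma path_connected_in_insert:
  assumes "path_connected_in S" "(x, v) \<in> parcs G" "x \<in> S" "v \<notin> S"
  shows "path_connected_in (insert v S)"
  unfolding path_connected_in_def
proof (intro ballI)
  have vx: "(v, x) \<in> parcs G" using assms(2) by (rule arcs_symmetric)
  have v: "v \<in> pverts G" using assms(2) by (rule in_arcsD2)
  fix u w assume uw: "u \<in> insert v S" "w \<in> insert v S"
  have to_v: "\<exists>p. apath v p w \<and> set (awalk_verts v p) \<subseteq> insert v S" if w: "w \<in> S" for w
  proof -
    obtain p where "apath x p w" "set (awalk_verts x p) \<subseteq> S"
      using assms(1,3) w unfolding path_connected_in_def by blast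
    then show ?thesis
      using vx assms(4) by (intro exI[of _ "(v, x) # p"]) (auto simp: apath_Cons_iff)
  qed
  show "\<exists>p. apath u p w \<and> set (awalk_verts u p) \<subseteq> insert v S"
  proof (cases "u = v")
    case True
    show ?thesis
    proof (cases "w = v")
      case True
      then show ?thesis using \<open>u = v\<close> v by (intro exI[of _ "[]"]) (simp add: apath_Nil_iff)
    next
      case False
      then show ?thesis using to_v uw \<open>u = v\<close> by blast
    qed
  next
    case False
    then have u: "u \<in> S" using uw by simp
    show ?thesis
    proof (cases "w = v")
      case True
      obtain p where "apath v p u" "set (awalk_verts v p) \<subseteq> insert v S"
        using to_v u by blast
      then show ?thesis
        using True by (intro exI[of _ "rev_path p"])
          (simp add: awalk_verts_rev_path[OF awalkI_apath])
    next
      case False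
      then show ?thesis
        using assms(1) u uw unfolding path_connected_in_def by blast
    qed
  qed
qed

text \<open>Two neighbours of \<open>v\<close> in \<open>S\<close> would close a cycle through \<open>v\<close>.\<close>

lemma unique_neighbour_into_connected:
  assumes "path_connected_in S" "\<not> (\<exists>c. cycle c \<and> 3 \<le> length c)"
    and "(x, v) \<in> parcs G" "x \<in> S" "v \<notin> S" "(y, v) \<in> parcs G" "y \<in> S"
  shows "y = x"
proof (rule ccontr)
  assume "y \<noteq> x"
  obtain p where p: "apath x p y" "set (awalk_verts x p) \<subseteq> S"
    using assms unfolding path_connected_in_def by blast
  have p_ne: "p \<noteq> []"
    using p \<open>y \<noteq> x\<close> by (auto simp: apath_Nil_iff)
  have yv: "awalk y [(y, v)] v"
    using assms(6) by (auto simp: awalk_simps intro: in_arcsD2)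
  have xv: "awalk x (p @ [(y, v)]) v"
    using awalkI_apath[OF p(1)] yv by (rule awalk_appendI)
  then have walk: "awalk v ((v, x) # p @ [(y, v)]) v"
    using assms(3) by (simp add: awalk_Cons_iff arcs_symmetric del: awalk_append_iff)
  have "awalk_verts x (p @ [(y, v)]) = awalk_verts x p @ [v]"
    using awalkI_apath[OF p(1)] awalk_verts_append[OF xv] by auto
  then have "cycle ((v, x) # p @ [(y, v)])"
    unfolding cycle_def using walk p assms(5)
    by (intro exI[of _ v]) (auto simp: apath_def)
  \<comment> \<open>As \<open>x\<close> and \<open>y\<close> differ, \<open>p\<close> has at least
    one arc. With the two arcs at \<open>v\<close> the closed walk is longer than the traversal of
    one edge back and forth.\<close>
  moreover have "3 \<le> length ((v, x) # p @ [(y, v)])"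
    using p_ne by (cases p) auto
  ultimately show False
    using assms(2) by blast
qed

text \<open>The set grows vertex by vertex. Connectedness supplies an edge leaving \<open>S\<close>,
  and acyclicity makes it the only edge between its new endpoint and \<open>S\<close>, so each
  vertex after the first adds exactly two arcs.\<close>

lemma tree_growth:
  assumes "connected (with_proj G)" "\<not> (\<exists>c. cycle c \<and> 3 \<le> length c)"
    and "m < card (pverts G)"
  shows "\<exists>S\<subseteq>pverts G. card S = Suc m \<and> path_connected_in S \<and>
           card (parcs G \<inter> S \<times> S) = 2 * m"
  using assms(3)
proof (induct m)
  case 0
  then obtain u where u: "u \<in> pverts G"
    by (metis card_gt_0_iff ex_in_conv)
  have "parcs G \<inter> {u} \<times> {u} = {}"
    using no_loops' by auto
  moreover have "path_connected_in {u}"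
    unfolding path_connected_in_def using u
    by (auto intro!: exI[of _ "[]"] simp: apath_Nil_iff)
  ultimately show ?case
    using u by (intro exI[of _ "{u}"]) auto
next
  case (Suc m)
  then obtain S where S: "S \<subseteq> pverts G" "card S = Suc m" "path_connected_in S"
      "card (parcs G \<inter> S \<times> S) = 2 * m"
    by auto
  have "finite S" "S \<noteq> {}" "S \<noteq> pverts G"
    using S Suc.prems finite_subset[OF S(1)] by auto
  then obtain x v where xv: "(x, v) \<in> parcs G" "x \<in> S" "v \<notin> S"
    using connected_boundary_arc[OF assms(1) S(1)] by blast
  have uniq: "y = x" if "(y, v) \<in> parcs G" "y \<in> S" for y
    using unique_neighbour_into_connected[OF S(3) assms(2) xv that] .
  have "parcs G \<inter> insert v S \<times> insert v S = (parcs G \<inter> S \<times> S) \<union> {(x, v), (v, x)}"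
    using xv uniq arcs_symmetric no_loops' by blast
  moreover have "card ((parcs G \<inter> S \<times> S) \<union> {(x, v), (v, x)}) = 2 * m + 2"
  proof -
    have "card {(x, v), (v, x)} = 2"
      using xv by (simp add: card_2_iff) blast
    then show ?thesis
      using xv S(4) by (subst card_Un_disjoint) auto
  qed
  moreover have "path_connected_in (insert v S)"
    using path_connected_in_insert[OF S(3) xv] .
  moreover have "card (insert v S) = Suc (Suc m)"
    using S \<open>finite S\<close> xv by simp
  moreover have "insert v S \<subseteq> pverts G"
    using S xv in_arcsD2 by blast
  ultimately show ?case
    by (intro exI[of _ "insert v S"]) simp
qed

lemma card_arcs_tree:
  assumes "connected (with_proj G)" "\<not> (\<exists>c. cycle c \<and> 3 \<le> length c)" "pverts G \<noteq> {}"
  shows "card (parcs G) = 2 * (card (pverts G) - 1)"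
proof -
  define m where "m = card (pverts G) - 1"
  have m: "card (pverts G) = Suc m"
    using assms(3) by (simp add: m_def card_gt_0_iff)
  then obtain S where S: "S \<subseteq> pverts G" "card S = Suc m" "card (parcs G \<inter> S \<times> S) = 2 * m"
    using tree_growth[OF assms(1,2), of m] by auto
  have "S = pverts G"
    using S m by (simp add: card_subset_eq)
  moreover have "parcs G \<inter> pverts G \<times> pverts G = parcs G"
    by (auto dest: in_arcsD1 in_arcsD2)
  ultimately show ?thesis
    using S m by simp
qed

end

lemma sum_degree_undirected_tree:
  assumes "undirected_tree T" "pverts T \<noteq> {}"
  shows "(\<Sum>v\<in>pverts T. degree T v) = 2 * (card (pverts T) - 1)"
proof -
  interpret pair_graph T using assms(1) by (simp add: undirected_tree_def)
  show ?thesis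
    using assms card_arcs_tree sum_degree by (simp add: undirected_tree_def)
qed

text \<open>The boundary of \<open>{v}\<close> contains an arc. Positivity is what keeps the
  natural-number subtraction in the excesses \<open>degree T v - 1\<close> exact.\<close>

lemma degree_pos_undirected_tree:
  assumes "undirected_tree T" "2 \<le> card (pverts T)" "v \<in> pverts T"
  shows "0 < degree T v"
proof -
  interpret pair_graph T using assms(1) by (simp add: undirected_tree_def)
  have "pverts T \<noteq> {v}"
  proof
    assume "pverts T = {v}"
    with assms(2) show False by simp
  qed
  then obtain w where "(v, w) \<in> parcs T"
    using connected_boundary_arc[of "{v}"] assms by (auto simp: undirected_tree_def)
  then have "(v, w) \<in> out_arcs T v"
    by (simp add: out_arcs_def)
  then show ?thesis
    unfolding degree_def out_degree_def by (metis card_gt_0_iff empty_iff finite_out_arcs)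
qed

section \<open>Minimal products with prescribed sum\<close>

definition greedy_prod :: "nat \<Rightarrow> nat \<Rightarrow> nat" where
  "greedy_prod c s = (c + 1) ^ (s div c) * (s mod c + 1)"

text \<open>The remainder stays an entry even when it is 0, so comparisons with this multiset are
  made only after zeros are removed.\<close>

definition greedy_mset :: "nat \<Rightarrow> nat \<Rightarrow> nat multiset" where
  "greedy_mset c s = replicate_mset (s div c) c + {#s mod c#}"

lemma greedy_prod_eq:
  assumes "m < c"
  shows "greedy_prod c (q * c + m) = (c + 1) ^ q * (m + 1)"
  using assms by (simp add: greedy_prod_def)

text \<open>Let \<open>m = s mod c\<close>. Without overflow, (m+1)(x+1) exceeds m+x+1 by m*x. If
  m+x = c+e, it exceeds (c+1)(e+1) by (c-m)(c-x). Both errors are nonnegative, and their vanishing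
  gives the equality cases.\<close>

lemma greedy_prod_step:
  assumes "x \<le> c" "0 < c"
  shows "greedy_prod c (s + x) \<le> greedy_prod c s * (x + 1)"
    and "greedy_prod c (s + x) = greedy_prod c s * (x + 1) \<Longrightarrow> x = 0 \<or> x = c \<or> s mod c = 0"
proof -
  define q m where "q = s div c" and "m = s mod c"
  have m: "m < c" using assms by (simp add: m_def)
  have s: "s = q * c + m" by (simp add: q_def m_def)
  have gs: "greedy_prod c s = (c + 1) ^ q * (m + 1)"
    unfolding s using m by (rule greedy_prod_eq)
  have "greedy_prod c (s + x) \<le> greedy_prod c s * (x + 1) \<and>
    (greedy_prod c (s + x) = greedy_prod c s * (x + 1) \<longrightarrow> x = 0 \<or> x = c \<or> m = 0)"
  proof (cases "m + x < c")
    case True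
    have eq: "greedy_prod c (s + x) = (c + 1) ^ q * (m + x + 1)"
      using greedy_prod_eq[OF True, of q] by (simp add: s add.assoc)
    have "(m + 1) * (x + 1) = (m + x + 1) + m * x" by (simp add: algebra_simps)
    then have "greedy_prod c s * (x + 1) = greedy_prod c (s + x) + (c + 1) ^ q * (m * x)"
      unfolding eq gs by (simp add: algebra_simps)
    then show ?thesis by auto
  next
    case False
    then obtain e where e: "m + x = c + e" using le_Suc_ex[of c "m + x"] by auto
    obtain a where a: "c = m + a" "0 < a" using m less_imp_add_positive by blast
    obtain b where b: "c = x + b" using assms le_Suc_ex by blast
    have abe: "m = b + e" "x = a + e" "c = a + b + e"
      using a b e by auto
    have sx: "s + x = (q + 1) * c + e" using e s by (simp add: algebra_simps)
    have eq: "greedy_prod c (s + x) = (c + 1) ^ (q + 1) * (e + 1)"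
      unfolding sx using abe a(2) by (intro greedy_prod_eq) simp
    have "(m + 1) * (x + 1) = (c + 1) * (e + 1) + a * b"
      by (simp add: abe algebra_simps)
    then have "(c + 1) ^ q * ((m + 1) * (x + 1)) = (c + 1) ^ q * ((c + 1) * (e + 1) + a * b)"
      by simp
    then have "greedy_prod c s * (x + 1) = greedy_prod c (s + x) + (c + 1) ^ q * (a * b)"
      unfolding eq gs by (simp add: algebra_simps)
    then show ?thesis using a b by auto
  qed
  then show "greedy_prod c (s + x) \<le> greedy_prod c s * (x + 1)"
    and "greedy_prod c (s + x) = greedy_prod c s * (x + 1) \<Longrightarrow> x = 0 \<or> x = c \<or> s mod c = 0"
    by (auto simp: m_def)
qed

lemma greedy_prod_le:
  assumes "0 < c" "\<And>x. x \<in># X \<Longrightarrow> x \<le> c"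
  shows "greedy_prod c (\<Sum>\<^sub># X) \<le> (\<Prod>x\<in>#X. x + 1)"
  using assms(2)
proof (induct X)
  case empty
  then show ?case by (simp add: greedy_prod_def)
next
  case (add x X)
  have "greedy_prod c (\<Sum>\<^sub># X + x) \<le> greedy_prod c (\<Sum>\<^sub># X) * (x + 1)"
    using add.prems assms(1) by (intro greedy_prod_step) auto
  also have "\<dots> \<le> (\<Prod>x\<in>#X. x + 1) * (x + 1)"
    using add by (intro mult_right_mono) auto
  finally show ?case by (simp add: ac_simps)
qed

text \<open>Equality for the whole multiset forces equality at every insertion, where
  \<open>greedy_prod_step\<close> leaves few choices for the new entry. Zeros affect neither the sum
  nor the product, so only nonzero entries are determined.\<close>

lemma greedy_prod_eqD:
  assumes "0 < c" "\<And>x. x \<in># X \<Longrightarrow> x \<le> c"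
    and "(\<Prod>x\<in>#X. x + 1) = greedy_prod c (\<Sum>\<^sub># X)"
  shows "filter_mset (\<lambda>x. x \<noteq> 0) X = filter_mset (\<lambda>x. x \<noteq> 0) (greedy_mset c (\<Sum>\<^sub># X))"
  using assms(2,3)
proof (induct X)
  case empty
  then show ?case by (simp add: greedy_mset_def)
next
  case (add x X)
  define s where "s = \<Sum>\<^sub># X"
  have x: "x \<le> c" using add.prems by simp
  have le: "greedy_prod c s \<le> (\<Prod>x\<in>#X. x + 1)"
    unfolding s_def using assms(1) add.prems by (intro greedy_prod_le) auto
  have step: "greedy_prod c (s + x) \<le> greedy_prod c s * (x + 1)"
    using x assms(1) by (rule greedy_prod_step)
  have eq: "greedy_prod c (s + x) = (\<Prod>x\<in>#X. x + 1) * (x + 1)"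
    using add.prems(2) by (simp add: s_def ac_simps)
  \<comment> \<open>Cancelling the positive factor \<open>x + 1\<close> gives the inequality
    opposite to \<open>le\<close>, so the induction hypothesis applies to \<open>X\<close>.\<close>
  have "(\<Prod>x\<in>#X. x + 1) * (x + 1) \<le> greedy_prod c s * (x + 1)"
    using eq step by simp
  then have prod: "(\<Prod>x\<in>#X. x + 1) = greedy_prod c s"
    using le by (simp only: mult_le_cancel2) simp
  have IH: "filter_mset (\<lambda>x. x \<noteq> 0) X = filter_mset (\<lambda>x. x \<noteq> 0) (greedy_mset c s)"
    using add.hyps add.prems prod by (auto simp: s_def)
  \<comment> \<open>The new entry is invisible, or one more full block, or it takes the place of a
    zero remainder.\<close>
  have "x = 0 \<or> x = c \<or> x < c \<and> s mod c = 0"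
    using greedy_prod_step(2)[OF x assms(1), of s] eq prod x by auto
  then have "filter_mset (\<lambda>x. x \<noteq> 0) (add_mset x (greedy_mset c s)) =
      filter_mset (\<lambda>x. x \<noteq> 0) (greedy_mset c (s + x))"
  proof (elim disjE conjE)
    assume "x < c" "s mod c = 0"
    then have "(s + x) div c = s div c" "(s + x) mod c = x"
      by auto
    then show ?thesis using \<open>s mod c = 0\<close> by (simp add: greedy_mset_def)
  qed (use assms(1) in \<open>auto simp: greedy_mset_def\<close>)
  then show ?case
    using IH by (auto simp: s_def add.commute split: if_splits)
qed

text \<open>Trade each factor c+2, of excess c+1, for a full block c and one more unit in the
  remainder \<open>m\<close>. This strictly increases the product, since (c+2)(m+1) < (c+1)(m+2)
  amounts to m < c.\<close>

lemma greedy_prod_shift: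
  assumes "0 < c" "1 \<le> k"
  shows "(c + 2) ^ k * greedy_prod c s < greedy_prod c (s + k * (c + 1))"
proof -
  have step: "(c + 2) * greedy_prod c t < greedy_prod c (t + (c + 1))" for t
  proof -
    define q m where "q = t div c" and "m = t mod c"
    have m: "m < c" using assms by (simp add: m_def)
    have t: "t = q * c + m" by (simp add: q_def m_def)
    \<comment> \<open>The formula survives the wrap-around at m + 1 = c, where the factor m + 2 is
      the new factor c + 1.\<close>
    have "greedy_prod c (t + 1) = (c + 1) ^ q * (m + 2)"
    proof (cases "m + 1 < c")
      case True
      then show ?thesis
        using greedy_prod_eq[OF True, of q] by (simp add: t)
    next
      case False
      then have c: "c = m + 1" using m by simp
      then have "t + 1 = (q + 1) * c + 0" by (simp add: t)
      then show ?thesis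
        using c greedy_prod_eq[of 0 c "q + 1"] assms(1) by simp
    qed
    moreover have "greedy_prod c (t + (c + 1)) = (c + 1) * greedy_prod c (t + 1)"
    proof -
      have "t + (c + 1) = (t + 1) + c" by simp
      moreover have "greedy_prod c (u + c) = (c + 1) * greedy_prod c u" for u
        using assms(1) by (simp add: greedy_prod_def algebra_simps)
      ultimately show ?thesis by metis
    qed
    ultimately have "greedy_prod c (t + (c + 1)) = (c + 1) ^ q * ((c + 1) * (m + 2))"
      by (simp only: mult.left_commute)
    moreover have "(c + 2) * greedy_prod c t = (c + 1) ^ q * ((c + 2) * (m + 1))"
      by (simp only: greedy_prod_def q_def m_def mult.left_commute)
    moreover have "(c + 2) * (m + 1) < (c + 1) * (m + 2)"
      using m by (simp add: algebra_simps)
    ultimately show ?thesis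
      by simp
  qed
  show ?thesis
    using assms(2)
  proof (induct k rule: nat_induct_at_least)
    case base
    then show ?case using step[of s] by simp
  next
    case (Suc k)
    have "(c + 2) ^ Suc k * greedy_prod c s < (c + 2) * greedy_prod c (s + k * (c + 1))"
      using Suc.hyps by (simp only: power_Suc mult.assoc mult_less_cancel1) simp
    also have "\<dots> < greedy_prod c (s + k * (c + 1) + (c + 1))"
      by (rule step)
    finally show ?case by (simp add: ac_simps)
  qed
qed

text \<open>To be read with \<open>X\<close> the excesses, \<open>a\<close> their maximum, c =
  \<Delta> - 2 and \<open>r\<close> the sum left after \<open>k\<close> excesses of size c +
  1.\<close>

lemma prod_Suc_fixed_max_multiplicity:
  assumes "0 < c" "1 \<le> k" "r < k"
    and "\<Sum>\<^sub># X = r + k * (c + 1)"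
    and "\<And>x. x \<in># X \<Longrightarrow> x \<le> a" and "count X a = k"
  shows "(c + 2) ^ k * greedy_prod c r \<le> (\<Prod>x\<in>#X. x + 1)"
    and "(\<Prod>x\<in>#X. x + 1) = (c + 2) ^ k * greedy_prod c r \<Longrightarrow>
      filter_mset (\<lambda>x. x \<noteq> 0) X =
        filter_mset (\<lambda>x. x \<noteq> 0) (replicate_mset k (c + 1) + greedy_mset c r)"
proof -
  define Y where "Y = filter_mset (\<lambda>x. x \<noteq> a) X"
  have "filter_mset (\<lambda>x. x = a) X = replicate_mset k a"
    using filter_eq_replicate_mset[of a X] assms(6) by simp
  then have X: "X = replicate_mset k a + Y"
    using multiset_partition[of X "\<lambda>x. x = a"] by (simp add: Y_def)
  have Y: "y < a" if "y \<in># Y" for y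
    using that assms(5)[of y] by (simp add: Y_def)
  have sum: "k * a + \<Sum>\<^sub># Y = r + k * (c + 1)"
    using assms(4) by (simp add: X)
  \<comment> \<open>The \<open>k\<close> copies of \<open>a\<close> alone sum to at most r + k(c+1),
    and r < k.\<close>
  have "k * a < k * (c + 2)"
    using sum assms(3) by (simp add: algebra_simps)
  then have "a \<le> c + 1"
    by (simp only: mult_less_cancel1) simp
  then consider "a \<le> c" | "a = c + 1"
    by linarith
  then have "(c + 2) ^ k * greedy_prod c r \<le> (\<Prod>x\<in>#X. x + 1) \<and>
    ((\<Prod>x\<in>#X. x + 1) = (c + 2) ^ k * greedy_prod c r \<longrightarrow>
      filter_mset (\<lambda>x. x \<noteq> 0) X =
        filter_mset (\<lambda>x. x \<noteq> 0) (replicate_mset k (c + 1) + greedy_mset c r))"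
  proof cases
    case 1
    \<comment> \<open>All entries are at most \<open>c\<close> here. The shift lemma then makes the
      bound strict, so the equality claim is vacuous.\<close>
    have "greedy_prod c (r + k * (c + 1)) \<le> (\<Prod>x\<in>#X. x + 1)"
      using greedy_prod_le[of c X] assms(1,4,5) 1 by (metis le_trans)
    then show ?thesis
      using greedy_prod_shift[OF assms(1,2), of r] by linarith
  next
    case 2
    have Y_le: "\<And>y. y \<in># Y \<Longrightarrow> y \<le> c" and sum_Y: "\<Sum>\<^sub># Y = r"
      using Y sum 2 by force+
    have "(\<Prod>x\<in>#X. x + 1) = (c + 2) ^ k * (\<Prod>x\<in>#Y. x + 1)"
      by (simp add: X 2)
    then show ?thesis
      using greedy_prod_le[OF assms(1) Y_le] greedy_prod_eqD[OF assms(1) Y_le] sum_Y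
      by (auto simp: X 2)
  qed
  then show "(c + 2) ^ k * greedy_prod c r \<le> (\<Prod>x\<in>#X. x + 1)"
    and "(\<Prod>x\<in>#X. x + 1) = (c + 2) ^ k * greedy_prod c r \<Longrightarrow>
      filter_mset (\<lambda>x. x \<noteq> 0) X =
        filter_mset (\<lambda>x. x \<noteq> 0) (replicate_mset k (c + 1) + greedy_mset c r)"
    by auto
qed

text \<open>Multisets that agree away from \<open>z\<close> differ only in the multiplicity of
  \<open>z\<close>, which the sizes determine. With z = 0 this restores the vertices of excess 0,
  the leaves.\<close>

lemma eq_padded_mset:
  assumes "filter_mset (\<lambda>x. x \<noteq> z) X = filter_mset (\<lambda>x. x \<noteq> z) Y" "size Y \<le> size X"
  shows "X = Y + replicate_mset (size X - size Y) z"
proof -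
  have split: "Z = filter_mset (\<lambda>x. x \<noteq> z) Z + replicate_mset (count Z z) z" for Z :: "'a multiset"
    using multiset_partition[of Z "\<lambda>x. x \<noteq> z"] filter_eq_replicate_mset[of z Z] by simp
  have "size Z = size (filter_mset (\<lambda>x. x \<noteq> z) Z) + count Z z" for Z :: "'a multiset"
    using arg_cong[OF split[of Z], of size] by simp
  then have "count X z = count Y z + (size X - size Y)"
    using assms by (metis Nat.add_diff_assoc add_left_imp_eq le_add_diff_inverse add.assoc)
  then have "X = filter_mset (\<lambda>x. x \<noteq> z) Y + replicate_mset (count Y z) z
      + replicate_mset (size X - size Y) z"
    using split[of X] assms(1) by (simp add: multiset_eq_iff)
  then show ?thesis
    using split[of Y] by simp
qed

section \<open>Degree multisets and the final theorem\<close>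

definition degree_mset :: "'a pair_pre_digraph \<Rightarrow> nat multiset" where
  "degree_mset G = image_mset (degree G) (mset_set (pverts G))"

lemma first_mult_zagreb_eq: "first_mult_zagreb G = (\<Prod>\<^sub># (degree_mset G))\<^sup>2"
  by (simp add: first_mult_zagreb_def degree_mset_def prod_unfold_prod_mset prod_power_distrib
      flip: prod_unfold_prod_mset)

lemma mset_degree_sequence: "mset (degree_sequence G) = degree_mset G"
  by (simp add: degree_sequence_def degree_mset_def)

lemma degree_sequence_eq_iff:
  assumes "sorted (rev L)"
  shows "degree_sequence G = L \<longleftrightarrow> degree_mset G = mset L"
proof
  assume "degree_mset G = mset L"
  then have "degree_mset G = mset (rev L)" by simp
  then have "sorted_list_of_multiset (degree_mset G) = rev L"
    using assms by (simp only: sorted_list_of_multiset_mset sorted_sort_id)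
  then show "degree_sequence G = L"
    by (simp add: degree_sequence_def flip: degree_mset_def)
qed (simp flip: mset_degree_sequence)

theorem theorem3p1:
  fixes n k :: nat and T :: "'a pair_pre_digraph" and \<Delta> p \<mu> :: int
  assumes "1 \<le> k" and "real k \<le> real n / 2 - 1"
    and "T \<in> tree_class n k"
    and "\<Delta> = \<lfloor>(real n - 2) / real k\<rfloor> + 1"
    and "p = \<lfloor>(real n - 2 - real k * (real_of_int \<Delta> - 1)) / (real_of_int \<Delta> - 2)\<rfloor>"
    and "\<mu> = int n - 1 - int k * (\<Delta> - 1) - p * (\<Delta> - 2)"
  shows "int (first_mult_zagreb T) \<ge> \<Delta> ^ (2 * k) * (\<Delta> - 1) ^ (2 * nat p) * \<mu>\<^sup>2 \<and>
    (int (first_mult_zagreb T) = \<Delta> ^ (2 * k) * (\<Delta> - 1) ^ (2 * nat p) * \<mu>\<^sup>2 \<longleftrightarrow>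
      map int (degree_sequence T) =
        replicate k \<Delta> @ replicate (nat p) (\<Delta> - 1) @ [\<mu>] @
        replicate (nat (int n - int k - p - 1)) 1)"
proof -
  have "real (2 * k + 2) \<le> real n"
    using assms(2) by simp
  then have n: "2 * k + 2 \<le> n"
    by (simp only: of_nat_le_iff)
  \<comment> \<open>Natural-number counterparts of the given quantities: \<open>c\<close> is
    \<Delta> - 2, \<open>r\<close> is n - 2 - k(\<Delta> - 1), \<open>P\<close> is p and
    \<open>m\<close> is \<mu>. The bound 2k + 2 \<le> n makes \<open>c\<close> positive.\<close>
  define c where "c = (n - 2) div k - 1"
  define r where "r = (n - 2) mod k"
  define P where "P = r div c"
  define m where "m = r mod c + 1"
  have "2 \<le> (n - 2) div k"
    using n assms(1) by (simp add: less_eq_div_iff_mult_less_eq)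
  then have c: "0 < c" and q: "(n - 2) div k = c + 1"
    by (simp_all add: c_def)
  have r: "r < k"
    using assms(1) by (simp add: r_def)
  have n_eq: "n = r + k * (c + 1) + 2"
    using n q mod_mult_div_eq[of "n - 2" k] by (simp add: r_def)
  have Delta: "\<Delta> = int (c + 2)"
  proof -
    have "\<lfloor>(real n - 2) / real k\<rfloor> = \<lfloor>real (n - 2) / real k\<rfloor>"
      using n by (simp add: of_nat_diff)
    then show ?thesis
      using assms(4) by (simp add: floor_divide_of_nat_eq q)
  qed
  have p: "p = int P"
  proof -
    have "real n - 2 - real k * (real_of_int \<Delta> - 1) = real r" "real_of_int \<Delta> - 2 = real c"
      by (simp_all add: n_eq Delta algebra_simps)
    then show ?thesis
      using assms(5) by (simp add: floor_divide_of_nat_eq P_def)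
  qed
  \<comment> \<open>\<mu> is a degree, hence one more than the excess \<open>r mod c\<close>; this
    is why its formula starts from n - 1 and not n - 2.\<close>
  have "int r = int P * int c + int (r mod c)"
    by (simp add: P_def flip: of_nat_mult of_nat_add)
  then have mu: "\<mu> = int m"
    using assms(6) by (simp add: n_eq Delta p m_def algebra_simps)
  define B where "B = (c + 2) ^ k * greedy_prod c r"
  have B: "B = (c + 2) ^ k * (c + 1) ^ P * m"
    by (simp only: B_def greedy_prod_def P_def m_def mult.assoc)
  have target: "\<Delta> ^ (2 * k) * (\<Delta> - 1) ^ (2 * nat p) * \<mu>\<^sup>2 = int (B\<^sup>2)"
  proof -
    have "\<Delta> - 1 = int (c + 1)" using Delta by simp
    then show ?thesis
      unfolding B p mu Delta
      by (simp only: nat_int of_nat_mult of_nat_power power_mult_distrib flip: power_mult)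
         (simp only: mult.commute[of 2])
  qed

  have tree: "undirected_tree T" and card: "card (pverts T) = n"
    and count: "card {v \<in> pverts T. degree T v = max_degree T} = k"
    using assms(3) by (auto simp: tree_class_def)
  have fin: "finite (pverts T)"
    using card n by (intro card_ge_0_finite) simp
  have pos: "0 < degree T v" if "v \<in> pverts T" for v
    using degree_pos_undirected_tree[OF tree _ that] card n by simp
  define a where "a = max_degree T - 1"
  define X where "X = image_mset (\<lambda>v. degree T v - 1) (mset_set (pverts T))"
  have D: "degree_mset T = image_mset Suc X"
    unfolding degree_mset_def X_def multiset.map_comp o_def using pos fin
    by (intro image_mset_cong) simp
  have size_X: "size X = n"
    by (simp add: X_def card)
  have sum_X: "\<Sum>\<^sub># X = r + k * (c + 1)"
  proof -
    have "(\<Sum>v\<in>pverts T. degree T v) = (\<Sum>v\<in>pverts T. (degree T v - 1) + 1)"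
      using pos by (intro sum.cong) simp_all
    also have "\<dots> = \<Sum>\<^sub># X + n"
      unfolding X_def sum.distrib by (simp add: card flip: sum_unfold_sum_mset)
    finally have "\<Sum>\<^sub># X + n = (\<Sum>v\<in>pverts T. degree T v)"
      by simp
    moreover have "pverts T \<noteq> {}"
      using card n by auto
    ultimately have "\<Sum>\<^sub># X + n = 2 * (n - 1)"
      using sum_degree_undirected_tree[OF tree] card by simp
    \<comment> \<open>The excesses sum to 2(n-1) - n = n - 2.\<close>
    then show ?thesis
      using n_eq by linarith
  qed
  have le_a: "x \<le> a" if "x \<in># X" for x
    using that fin by (auto simp: X_def a_def max_degree_def intro!: diff_le_mono)
  have count_X: "count X a = k"
  proof -
    \<comment> \<open>A vertex attains the maximum because 1 \<le> k, so the maximum is positive.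
      Among positive degrees, subtracting 1 merges no two values.\<close>
    have "{v \<in> pverts T. degree T v = max_degree T} \<noteq> {}"
      using count assms(1) by (metis card.empty not_one_le_zero)
    then have "1 \<le> max_degree T"
      using pos by force
    then have "{v \<in> pverts T. degree T v - 1 = a} = {v \<in> pverts T. degree T v = max_degree T}"
      using pos unfolding a_def by force
    then show ?thesis
      using count fin by (simp add: X_def count_image_mset_eq_card_vimage eq_commute)
  qed
  have zagreb: "first_mult_zagreb T = (\<Prod>x\<in>#X. x + 1)\<^sup>2"
    by (simp add: first_mult_zagreb_eq D)
  have bound: "B \<le> (\<Prod>x\<in>#X. x + 1)"
    and filter_X: "(\<Prod>x\<in>#X. x + 1) = B \<Longrightarrow> filter_mset (\<lambda>x. x \<noteq> 0) X =
      filter_mset (\<lambda>x. x \<noteq> 0) (replicate_mset k (c + 1) + greedy_mset c r)"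
    using prod_Suc_fixed_max_multiplicity[OF c assms(1) r sum_X le_a count_X]
    by (simp_all only: B_def)

  define L where "L = replicate k (c + 2) @ replicate P (c + 1) @ [m] @ replicate (n - k - P - 1) 1"
  \<comment> \<open>This puts \<open>m\<close> below the entries c + 1, while m \<ge> 1 puts it
    before the final ones, so \<open>L\<close> is non-increasing.\<close>
  have "m \<le> c"
    using c by (simp add: m_def Suc_le_eq)
  then have sorted_L: "sorted (rev L)"
    by (auto simp: L_def sorted_append m_def)
  have "map int L = replicate k \<Delta> @ replicate (nat p) (\<Delta> - 1) @ [\<mu>] @
      replicate (nat (int n - int k - p - 1)) 1"
  proof -
    have "nat (int n - int k - p - 1) = n - k - P - 1"
      using p by linarith
    then show ?thesis
      by (simp add: L_def Delta p mu)
  qed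
  then have seq: "map int (degree_sequence T) = replicate k \<Delta> @ replicate (nat p) (\<Delta> - 1) @ [\<mu>] @
      replicate (nat (int n - int k - p - 1)) 1 \<longleftrightarrow> degree_mset T = mset L"
    using degree_sequence_eq_iff[OF sorted_L, of T] by (metis inj_map_eq_map inj_of_nat)

  have "degree_mset T = mset L" if eq: "(\<Prod>x\<in>#X. x + 1) = B"
  proof -
    \<comment> \<open>Needed so that the natural-number subtraction n - k - P - 1 is not truncated.
      The zeros padded below become that many entries 1 under \<open>Suc\<close>.\<close>
    have "P \<le> r" by (simp add: P_def)
    then have size_le: "k + P + 1 \<le> n"
      using n_eq by simp
    have "X = replicate_mset k (c + 1) + greedy_mset c r +
        replicate_mset (n - (k + (P + 1))) 0"
      using eq_padded_mset[OF filter_X[OF eq]] size_le size_X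
      by (simp add: greedy_mset_def P_def)
    then show ?thesis
      unfolding D L_def by (simp add: greedy_mset_def P_def m_def)
  qed
  moreover have "(\<Prod>x\<in>#X. x + 1) = B" if "degree_mset T = mset L"
  proof -
    have "(\<Prod>x\<in>#X. x + 1) = \<Prod>\<^sub># (degree_mset T)"
      by (simp add: D)
    then show ?thesis
      using that by (simp add: L_def B)
  qed
  ultimately show ?thesis
    unfolding target seq zagreb using bound by (auto simp: power_mono)
qed

end
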